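(* Let $p\neq 5$ be a prime. Then for every residue class $m\in\mathbf{Z}_p^*$ there exist an integer $t\ge 2$ and integers $x_1,\dots,x_t\ge 1$ with $x_1+\cdots+x_t=p$ such that $x_1!\,x_2!\cdots x_t!\equiv m \pmod p$. That is, $\bigcup_{t\ge 2}P_{p,t}(p)=\mathbf{Z}_p^*$.
   Context: For a prime $p$ and positive integers $s,t$, $P_{s,t}(p)=\{x_1!\,x_2!\cdots x_t! \pmod p \;:\; x_i\ge 1,\ \sum_{i=1}^t x_i=s\}$. $\mathbf{Z}_p^*$ denotes the set of nonzero residue classes modulo $p$. (Equivalently, the numbers $\frac{1}{p}\binom{p}{m_1,\dots,m_t}$ with $t\ge 2$, $m_i\ge1$, $\sum m_i=p$, cover all of $\mathbf{Z}_p^*$ modulo $p$.) *)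

theory Defs
  imports "HOL-Number_Theory.Number_Theory"
begin

text \<open>
  Residue classes modulo \<open>p\<close> are represented, as in \<^const>\<open>residue_ring\<close>, by the integers
  \<open>0, \<dots>, p - 1\<close>.
\<close>

definition nonzero_residues :: "nat \<Rightarrow> int set" where
  "nonzero_residues p = carrier (residue_ring (int p)) - {\<zero>\<^bsub>residue_ring (int p)\<^esub>}"

text \<open>
  A tuple \<open>(x\<^sub>1, \<dots>, x\<^sub>t)\<close> is a function on \<open>nat\<close> of which only the values on \<open>{1..t}\<close> matter.
\<close>

definition factorial_products :: "nat \<Rightarrow> nat \<Rightarrow> nat \<Rightarrow> int set" where
  "factorial_products s t p =
     {(\<Prod>i = 1..t. fact (x i)) mod int p | x :: nat \<Rightarrow> nat.
        (\<forall>i \<in> {1..t}. x i \<ge> 1) \<and> (\<Sum>i = 1..t. x i) = s}"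

end

theory Submission
  imports Defs "HOL-Library.Discrete_Functions"
begin

text \<open>
  Parts equal to \<open>1\<close> are free padding, so it suffices to write \<open>m\<close> as a product of factorials
  whose arguments sum to at most \<open>p\<close>. Let \<open>R = \<lfloor>\<surd>p\<rfloor>\<close>, \<open>r = p - R\<^sup>2\<close> and
  \<open>B = 0! 1! \<dots> R!\<close>, of total weight about \<open>p/2\<close>. Replacing \<open>(a - 1)!\<close> by \<open>a!\<close> and \<open>b!\<close> by
  \<open>(b - 1)!\<close> in \<open>B\<close> multiplies it by \<open>a / b\<close> without changing the weight, and by Thue's lemma
  every residue is \<open>\<plusminus> a / b\<close> with \<open>1 \<le> a, b \<le> R\<close>. The sign is absorbed by the two products
  \<open>(R - 1)!\<^sup>2 r!\<close> and \<open>R!\<^sup>2 (r - 1)!\<close>, which are negatives of each other because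
  \<open>R\<^sup>2 \<equiv> - r\<close>. The weights fit as soon as \<open>R \<ge> 6\<close>; for \<open>p \<le> 31\<close> products of \<open>2!\<close>, \<open>3!\<close> and
  \<open>5!\<close> suffice.
\<close>

section \<open>Products of factorials and padding to weight \<open>p\<close>\<close>

definition fact_prod :: "nat list \<Rightarrow> int" where
  "fact_prod xs = prod_list (map fact xs)"

lemma fact_prod_simps [simp]:
  "fact_prod [] = 1"
  "fact_prod (x # xs) = fact x * fact_prod xs"
  "fact_prod (xs @ ys) = fact_prod xs * fact_prod ys"
  by (simp_all add: fact_prod_def)

lemma fact_prod_replicate [simp]: "fact_prod (replicate n x) = fact x ^ n"
  by (induction n) auto

lemma fact_prod_filter_pos: "fact_prod (filter (\<lambda>x. 0 < x) xs) = fact_prod xs"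
  by (induction xs) auto

lemma sum_list_filter_pos: "sum_list (filter (\<lambda>x. 0 < x) xs) = sum_list (xs :: nat list)"
  by (induction xs) auto

lemma fact_prod_map_upt: "fact_prod (map f [0..<n]) = (\<Prod>j<n. fact (f j))"
  by (induction n) (auto simp: mult.commute)

lemma sum_list_map_upt: "sum_list (map f [0..<n]) = (\<Sum>j<n. f j :: nat)"
  by (induction n) auto

text \<open>A relaxed form of the goal: zero entries and total weight below \<open>p\<close> are
  allowed, so that weights need only be bounded from above.\<close>

definition is_fact_prod_mod :: "nat \<Rightarrow> int \<Rightarrow> bool" where
  "is_fact_prod_mod p m \<longleftrightarrow> (\<exists>xs. sum_list xs \<le> p \<and> [fact_prod xs = m] (mod int p))"

text \<open>Since \<open>0! = 1! = 1\<close>, dropping zeros and appending ones changes the weight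
  to exactly \<open>p\<close> without changing the product.\<close>

lemma composition_of_is_fact_prod_mod:
  assumes "prime p" and "is_fact_prod_mod p m" and "\<not> int p dvd m"
  shows "\<exists>t \<ge> 2. \<exists>x :: nat \<Rightarrow> nat. (\<forall>i \<in> {1..t}. x i \<ge> 1) \<and> (\<Sum>i = 1..t. x i) = p \<and>
           [(\<Prod>i = 1..t. fact (x i)) = m] (mod int p)"
proof -
  obtain xs where xs: "sum_list xs \<le> p" "[fact_prod xs = m] (mod int p)"
    using assms(2) by (auto simp: is_fact_prod_mod_def)
  define ys where "ys = filter (\<lambda>x. 0 < x) xs @ replicate (p - sum_list xs) 1"
  define x where "x i = ys ! (i - 1)" for i
  have sum_ys: "sum_list ys = p"
    using xs(1) by (simp add: ys_def sum_list_filter_pos sum_list_replicate)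
  have prod_ys: "fact_prod ys = fact_prod xs"
    by (simp add: ys_def fact_prod_filter_pos)
  have pos: "\<forall>i \<in> {1..length ys}. x i \<ge> 1"
  proof
    fix i assume "i \<in> {1..length ys}"
    then have "x i \<in> set ys" by (auto simp: x_def)
    then show "x i \<ge> 1" by (auto simp: ys_def)
  qed
  have image: "{1..length ys} = Suc ` {..<length ys}"
    by (simp add: lessThan_atLeast0 image_Suc_atLeastLessThan atLeastLessThanSuc_atLeastAtMost)
  have sum_x: "(\<Sum>i = 1..length ys. x i) = p"
    unfolding image using sum_ys sum_list_map_upt[of "(!) ys" "length ys"]
    by (subst sum.reindex) (auto simp: x_def map_nth)
  have prod_x: "(\<Prod>i = 1..length ys. fact (x i)) = fact_prod ys"
    unfolding image using fact_prod_map_upt[of "(!) ys" "length ys"]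
    by (subst prod.reindex) (auto simp: x_def map_nth)
  \<comment> \<open>The empty list has sum 0, and a single part would be \<open>p\<close> itself,
    making \<open>p\<close> divide \<open>p!\<close> and hence \<open>m\<close>.\<close>
  have "length ys \<ge> 2"
  proof (rule ccontr)
    assume "\<not> 2 \<le> length ys"
    then consider "ys = []" | y where "ys = [y]"
      by (cases ys; cases "tl ys") auto
    then show False
    proof cases
      case 1
      then show ?thesis using sum_ys assms(1) by auto
    next
      case 2
      then have "fact_prod ys = fact p" using sum_ys by simp
      moreover have "int p dvd fact p"
        using assms(1) by (metis dvd_fact of_nat_dvd_iff of_nat_fact order_refl prime_ge_1_nat)
      ultimately show ?thesis
        using xs(2) prod_ys assms(3) cong_dvd_iff by metis
    qed
  qed
  then show ?thesis
    using pos sum_x prod_x prod_ys xs(2) by (intro exI[of _ "length ys"] conjI exI[of _ x]) auto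
qed

section \<open>Thue's lemma\<close>

text \<open>Pigeonhole: more than \<open>p\<close> pairs from \<open>{0..R}\<close> map to residues
  modulo \<open>p\<close>, and the difference of two colliding pairs gives \<open>a\<close> and
  \<open>b\<close> up to sign.\<close>

lemma thue_ratio:
  fixes m w :: int
  assumes p: "prime p" and R: "R < p" "p < (R + 1)\<^sup>2"
    and m: "\<not> int p dvd m" and w: "\<not> int p dvd w"
  obtains a b where "a \<in> {1..R}" "b \<in> {1..R}"
    "[int b * m = int a * w] (mod int p) \<or> [int b * m = - (int a * w)] (mod int p)"
proof -
  let ?D = "{0..R} \<times> {0..R}"
  let ?f = "\<lambda>(a, b). (int b * m - int a * w) mod int p"
  have "p > 0" using p prime_gt_0_nat by blast
  have "?f ` ?D \<subseteq> {0..<int p}" using \<open>p > 0\<close> by auto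
  then have "card (?f ` ?D) \<le> p" using card_mono[of "{0..<int p}"] by fastforce
  moreover have "card ?D = (R + 1)\<^sup>2" by (simp add: card_cartesian_product power2_eq_square)
  ultimately have "\<not> inj_on ?f ?D" using R(2) card_image by fastforce
  then obtain a1 b1 a2 b2 where ab: "a1 \<le> R" "a2 \<le> R" "b1 \<le> R" "b2 \<le> R" "(a1, b1) \<noteq> (a2, b2)"
    and eq: "(int b1 * m - int a1 * w) mod int p = (int b2 * m - int a2 * w) mod int p"
    by (auto simp: inj_on_def)
  define c d where "c = int a1 - int a2" and "d = int b1 - int b2"
  have dvd: "int p dvd d * m - c * w"
    using eq by (simp add: mod_eq_dvd_iff c_def d_def algebra_simps)
  have prime: "prime (int p)" using p by simp
  have bound: "\<bar>c\<bar> \<le> int R" "\<bar>d\<bar> \<le> int R" using ab by (auto simp: c_def d_def)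
  have zero: "e = 0" if "int p dvd e" "\<bar>e\<bar> \<le> int R" for e :: int
    using that R(1) zdvd_not_zless[of "\<bar>e\<bar>" "int p"] by fastforce
  \<comment> \<open>If one difference vanishes, \<open>p\<close> divides the other, which is smaller
    than \<open>p\<close>; then both vanish and the two pairs coincide.\<close>
  have "c \<noteq> 0 \<and> d \<noteq> 0"
  proof (intro conjI notI)
    assume "c = 0"
    then have "int p dvd d" using dvd m prime by (simp add: prime_dvd_mult_iff)
    with \<open>c = 0\<close> show False using zero[of d] bound ab by (auto simp: c_def d_def)
  next
    assume "d = 0"
    then have "int p dvd c" using dvd w prime by (simp add: prime_dvd_mult_iff)
    with \<open>d = 0\<close> show False using zero[of c] bound ab by (auto simp: c_def d_def)
  qed
  define a b where "a = nat \<bar>c\<bar>" and "b = nat \<bar>d\<bar>"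
  have "a \<in> {1..R}" "b \<in> {1..R}"
    using \<open>c \<noteq> 0 \<and> d \<noteq> 0\<close> bound by (auto simp: a_def b_def)
  moreover have "[int b * m = int a * w] (mod int p) \<or> [int b * m = - (int a * w)] (mod int p)"
  proof -
    have "int p dvd - (d * m - c * w)" using dvd by (subst dvd_minus_iff)
    with dvd show ?thesis
      by (auto simp: cong_iff_dvd_diff a_def b_def abs_if algebra_simps)
  qed
  ultimately show ?thesis using that by blast
qed

section \<open>Rescaling the superfactorial by a ratio\<close>

abbreviation superfact :: "nat \<Rightarrow> int" where
  "superfact R \<equiv> (\<Prod>j\<le>R. fact j)"

text \<open>Lowering \<open>b\<close> by one divides the product by \<open>b\<close>, and raising
  \<open>a - 1\<close> by one multiplies it by \<open>a\<close>. The condition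
  \<open>a \<noteq> b + 1\<close> keeps the two positions apart.\<close>

lemma superfact_scale:
  assumes b: "1 \<le> b" "b \<le> R" and a: "1 \<le> a" "a \<le> R + 1" and ne: "a \<noteq> b + 1"
  obtains ys where "int b * fact_prod ys = int a * superfact R" "sum_list ys = (\<Sum>j\<le>R. j)"
proof -
  define f where "f = (\<lambda>j::nat. j)(b := b - 1, a - 1 := a)"
  define S where "S = {..R} - {b, a - 1}"
  have S: "{..R} = insert b (insert (a - 1) S)" "finite S" "b \<notin> insert (a - 1) S" "a - 1 \<notin> S"
    using assms by (auto simp: S_def)
  have fS: "f j = j" if "j \<in> S" for j using that by (auto simp: f_def S_def)
  have fa: "f (a - 1) = a" and fb: "f b = b - 1" using ne a by (auto simp: f_def)
  have "(\<Prod>j\<le>R. fact (f j)) = fact (b - 1) * (fact a * (\<Prod>j\<in>S. fact j :: int))"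
    unfolding S(1) using S(2-4) fS by (simp add: fa fb del: One_nat_def)
  moreover have "superfact R = fact b * (fact (a - 1) * (\<Prod>j\<in>S. fact j :: int))"
    unfolding S(1) using S(2-4) by simp
  moreover have "fact b = int b * fact (b - 1)" "fact a = int a * fact (a - 1)"
    using a b by (auto simp: fact_reduce)
  ultimately have prod: "int b * (\<Prod>j\<le>R. fact (f j)) = int a * superfact R"
    by simp
  have "(\<Sum>j\<le>R. f j) = (b - 1) + (a + (\<Sum>j\<in>S. j))"
    unfolding S(1) using S(2-4) fS by (simp add: fa fb del: One_nat_def)
  moreover have "(\<Sum>j\<le>R. j) = b + ((a - 1) + (\<Sum>j\<in>S. j))"
    unfolding S(1) using S(2-4) by simp
  ultimately have sum: "(\<Sum>j\<le>R. f j) = (\<Sum>j\<le>R. j)" using a b by simp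
  show ?thesis
    by (rule that[of "map f [0..<Suc R]"])
      (use prod sum in \<open>simp_all only: fact_prod_map_upt sum_list_map_upt lessThan_Suc_atMost\<close>)
qed

text \<open>
  If \<open>a = b + 1\<close>, both replacements would act on the same factor \<open>b!\<close>. The spare \<open>2!\<close> allows
  to halve whichever of \<open>a\<close> and \<open>b\<close> is even.
\<close>

lemma two_superfact_scale:
  assumes a: "a \<in> {1..R}" and b: "b \<in> {1..R}"
  obtains ys where "int b * fact_prod ys = int a * (2 * superfact R)"
    "sum_list ys \<le> (\<Sum>j\<le>R. j) + 4"
proof (cases "a = b + 1")
  case False
  then obtain ys where "int b * fact_prod ys = int a * superfact R" "sum_list ys = (\<Sum>j\<le>R. j)"
    using superfact_scale[of b R a] a b by auto
  then show ?thesis by (intro that[of "2 # ys"]) auto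
next
  case True
  show ?thesis
  proof (cases "even b")
    case True
    then obtain c where c: "b = 2 * c" by blast
    obtain ys where "int c * fact_prod ys = int a * superfact R" "sum_list ys = (\<Sum>j\<le>R. j)"
      \<comment> \<open>Here \<open>a = 2 * c + 1\<close> differs from \<open>c + 1\<close> because
        \<open>c \<ge> 1\<close>.\<close>
      using superfact_scale[of c R a] a b c \<open>a = b + 1\<close> by auto
    then show ?thesis using c by (intro that[of ys]) auto
  next
    case False
    then obtain c where c: "a = 2 * c" using \<open>a = b + 1\<close> by (metis even_Suc evenE Suc_eq_plus1)
    obtain ys where "int b * fact_prod ys = int c * superfact R" "sum_list ys = (\<Sum>j\<le>R. j)"
      using superfact_scale[of b R c] a b c \<open>a = b + 1\<close> by auto
    \<comment> \<open>One \<open>2!\<close> turns \<open>c\<close> back into \<open>a\<close>, the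
      other is the factor 2 of the claim; this case accounts for the extra weight 4.\<close>
    then show ?thesis using c by (intro that[of "2 # 2 # ys"]) auto
  qed
qed

section \<open>Primes at least 36\<close>

lemma not_prime_dvd_fact_prod:
  assumes "prime p" and "\<And>x. x \<in> set xs \<Longrightarrow> x < p"
  shows "\<not> int p dvd fact_prod xs"
  using assms(2)
proof (induction xs)
  case Nil
  then show ?case using assms(1) by (auto simp: prime_gt_1_nat)
next
  case (Cons x xs)
  have "\<not> int p dvd fact x"
    using Cons.prems[of x] assms(1)
    by (metis int_dvd_int_iff list.set_intros(1) not_le of_nat_fact prime_dvd_fact_iff)
  with Cons assms(1) show ?case by (simp add: prime_dvd_mult_iff)
qed

lemma is_fact_prod_mod_large:
  assumes p: "prime p" and large: "p \<ge> 36" and m: "\<not> int p dvd m"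
  shows "is_fact_prod_mod p m"
proof -
  define R where "R = floor_sqrt p"
  define r where "r = p - R\<^sup>2"
  have "R\<^sup>2 \<le> p" and R2: "p < (R + 1)\<^sup>2"
    using floor_sqrt_power2_le Suc_floor_sqrt_power2_gt by (auto simp: R_def)
  \<comment> \<open>A prime is not a square, so \<open>r \<ge> 1\<close> and \<open>(r - 1)!\<close>
    is a genuine step down from \<open>r!\<close>.\<close>
  moreover have "R\<^sup>2 \<noteq> p" using p by (auto simp: prime_power_iff)
  ultimately have "R\<^sup>2 < p" by simp
  then have r: "p = R\<^sup>2 + r" "r \<ge> 1" by (auto simp: r_def)
  have "R \<ge> 6"
  proof (rule ccontr)
    assume "\<not> R \<ge> 6"
    then have "(R + 1)\<^sup>2 \<le> 6\<^sup>2" by (intro power_mono) auto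
    with R2 large show False by simp
  qed
  then have R6: "6 * R \<le> R\<^sup>2" by (simp add: power2_eq_square)
  then have "R < p" "r < p" using r \<open>R \<ge> 6\<close> by auto
  define us where "us = [R - 1, R - 1, r]"
  define vs where "vs = [R, R, r - 1]"
  have factR: "fact R = int R * fact (R - 1)" and factr: "fact r = int r * fact (r - 1)"
    using r(2) \<open>R \<ge> 6\<close> by (simp_all add: fact_reduce)
  \<comment> \<open>The cofactor of the common part \<open>(R - 1)!\<^sup>2 (r - 1)!\<close> is
    \<open>R\<^sup>2 + r = p\<close>.\<close>
  have "fact_prod vs + fact_prod us = int p * ((fact (R - 1))\<^sup>2 * fact (r - 1))"
    by (simp add: us_def vs_def factR factr r(1) power2_eq_square algebra_simps)
  then have neg: "[fact_prod vs = - fact_prod us] (mod int p)"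
    by (simp add: cong_iff_dvd_diff)
  \<comment> \<open>The whole product before rescaling: Thue's lemma then expresses \<open>m\<close>
    as \<open>w\<close> times a ratio, up to a sign that replacing \<open>us\<close> by
    \<open>vs\<close> corrects.\<close>
  define w where "w = 2 * superfact R * fact_prod us"
  have "w = fact_prod (2 # map (\<lambda>j. j) [0..<Suc R] @ us)"
    unfolding w_def fact_prod_simps fact_prod_map_upt lessThan_Suc_atMost by simp
  moreover have "\<not> int p dvd fact_prod (2 # map (\<lambda>j. j) [0..<Suc R] @ us)"
    using \<open>R < p\<close> \<open>r < p\<close> large by (intro not_prime_dvd_fact_prod[OF p]) (auto simp: us_def)
  ultimately have "\<not> int p dvd w" by simp
  then obtain a b where ab: "a \<in> {1..R}" "b \<in> {1..R}"
    and thue: "[int b * m = int a * w] (mod int p) \<or> [int b * m = - (int a * w)] (mod int p)"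
    using thue_ratio[OF p \<open>R < p\<close> R2 m] by blast
  obtain ys where ys: "int b * fact_prod ys = int a * (2 * superfact R)"
    "sum_list ys \<le> (\<Sum>j\<le>R. j) + 4"
    using two_superfact_scale[OF ab] .
  have bys: "int b * fact_prod (ys @ zs) = int a * (2 * superfact R) * fact_prod zs" for zs
    using ys(1) by (simp add: mult.assoc [symmetric])
  have "\<exists>zs\<in>{us, vs}. [int b * fact_prod (ys @ zs) = int b * m] (mod int p)"
    using thue
  proof
    assume "[int b * m = int a * w] (mod int p)"
    then have "[int b * fact_prod (ys @ us) = int b * m] (mod int p)"
      unfolding bys by (simp add: w_def mult.assoc cong_sym)
    then show ?thesis by blast
  next
    assume *: "[int b * m = - (int a * w)] (mod int p)"
    have "[int b * fact_prod (ys @ vs) = int a * (2 * superfact R) * - fact_prod us] (mod int p)"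
      unfolding bys using neg by (rule cong_scalar_left)
    also have "int a * (2 * superfact R) * - fact_prod us = - (int a * w)"
      by (simp add: w_def)
    finally show ?thesis using * cong_sym cong_trans by blast
  qed
  then obtain zs where zs: "zs \<in> {us, vs}"
    and cong: "[int b * fact_prod (ys @ zs) = int b * m] (mod int p)" by blast
  have "coprime (int b) (int p)"
    using ab(2) \<open>R < p\<close> p
    by (metis atLeastAtMost_iff coprime_commute coprime_int_iff leD le_less_trans less_le_trans
        less_one nat_dvd_not_less prime_imp_coprime zero_less_one)
  with cong have "[fact_prod (ys @ zs) = m] (mod int p)"
    by (simp add: cong_mult_lcancel)
  \<comment> \<open>The bound
    \<open>(R\<^sup>2 + R) / 2 + 4 + 2 * R + r - 1 \<le> R\<^sup>2 + r\<close> amounts to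
    \<open>5 * R + 6 \<le> R\<^sup>2\<close>, with equality at \<open>R = 6\<close>.\<close>
  moreover have "sum_list (ys @ zs) \<le> p"
  proof -
    have "2 * (\<Sum>j\<le>R. j) = R\<^sup>2 + R"
      using gauss_sum_nat[of R] by (simp add: atMost_atLeast0 power2_eq_square)
    moreover have "sum_list zs \<le> 2 * R + r - 1" using zs r(2) \<open>R \<ge> 6\<close> by (auto simp: us_def vs_def)
    ultimately show ?thesis using ys(2) R6 r \<open>R \<ge> 6\<close> by simp
  qed
  ultimately show ?thesis unfolding is_fact_prod_mod_def by blast
qed

section \<open>Primes below 36\<close>

lemma prime_less_36:
  assumes "prime p" "p < 36" "p \<noteq> 5"
  shows "int p \<in> set [2, 3, 7, 11, 13, 17, 19, 23, 29, 31]"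
proof (cases "p = 2 \<or> p = 3")
  case False
  have "\<not> q dvd p" if "prime q" "p \<noteq> q" for q :: nat
    using that assms(1) primes_dvd_imp_eq by blast
  from this[of 2] this[of 3] this[of 5] have "\<not> 2 dvd p" "\<not> 3 dvd p" "\<not> 5 dvd p"
    using False assms(3) by auto
  \<comment> \<open>Sieving by 2, 3 and 5 is enough, as \<open>36 < 7\<^sup>2\<close>.\<close>
  then have "p = 1 \<or> p = 7 \<or> p = 11 \<or> p = 13 \<or> p = 17 \<or> p = 19 \<or> p = 23 \<or> p = 29 \<or> p = 31"
    using assms(2) by presburger
  moreover have "p \<noteq> 1" using assms(1) by auto
  ultimately show ?thesis by auto
qed auto

text \<open>A finite search over the numbers \<open>i\<close>, \<open>j\<close>, \<open>k\<close> of
  factors \<open>2!\<close>, \<open>3!\<close>, \<open>5!\<close>. For \<open>p = 5\<close> the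
  residue 3 is out of reach: weight at most 5 gives only 0, 1, 2 and 4.\<close>

lemma small_prime_table:
  "\<forall>p\<in>set [2, 3, 7, 11, 13, 17, 19, 23, 29, 31]. \<forall>m\<in>set [1..p - 1].
     \<exists>k\<in>set [0..<2]. \<exists>j\<in>set [0..<4]. \<exists>i\<in>set [0..<9].
       int (2 * i + 3 * j + 5 * k) \<le> p \<and> 2 ^ i * 6 ^ j * 120 ^ k mod p = m"
  by code_simp

lemma is_fact_prod_mod_small:
  assumes "prime p" "p < 36" "p \<noteq> 5" and m: "0 < m" "m < int p"
  shows "is_fact_prod_mod p m"
proof -
  have "m \<in> set [1..int p - 1]" using m by auto
  then obtain i j k where *: "int (2 * i + 3 * j + 5 * k) \<le> int p"
    "2 ^ i * 6 ^ j * 120 ^ k mod int p = m"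
    using small_prime_table prime_less_36[OF assms(1-3)] by blast
  define xs where "xs = replicate i 2 @ replicate j 3 @ replicate k (5 :: nat)"
  have "fact_prod xs = 2 ^ i * 6 ^ j * 120 ^ k"
    by (simp add: xs_def fact_numeral)
  with *(2) have "[fact_prod xs = m] (mod int p)"
    by (metis cong_mod_left cong_refl)
  moreover have "sum_list xs \<le> p"
    using *(1) by (simp add: xs_def sum_list_replicate)
  ultimately show ?thesis unfolding is_fact_prod_mod_def by blast
qed

section \<open>From congruences to the equality of sets\<close>

lemma nonzero_residues_eq: "p > 1 \<Longrightarrow> nonzero_residues p = {0<..<int p}"
  by (auto simp: nonzero_residues_def residue_ring_def)

lemma composition_exists:
  assumes "prime p" "p \<noteq> 5" "m \<in> nonzero_residues p"
  shows "\<exists>t \<ge> 2. \<exists>x :: nat \<Rightarrow> nat. (\<forall>i \<in> {1..t}. x i \<ge> 1) \<and> (\<Sum>i = 1..t. x i) = p \<and>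
           [(\<Prod>i = 1..t. fact (x i)) = m] (mod int p)"
proof -
  have m: "0 < m" "m < int p"
    using assms nonzero_residues_eq[OF prime_gt_1_nat] by auto
  then have "\<not> int p dvd m" by (auto dest: zdvd_imp_le)
  moreover from this have "is_fact_prod_mod p m"
    using is_fact_prod_mod_large is_fact_prod_mod_small assms m by (cases "p < 36") auto
  ultimately show ?thesis using composition_of_is_fact_prod_mod assms(1) by blast
qed

text \<open>With at least two positive parts, every part is less than \<open>p\<close>, so
  \<open>p\<close> divides none of the factorials.\<close>

lemma factorial_products_subset:
  assumes "prime p" "t \<ge> 2"
  shows "factorial_products p t p \<subseteq> nonzero_residues p"
proof
  fix m assume "m \<in> factorial_products p t p"
  then obtain x :: "nat \<Rightarrow> nat" where x: "\<forall>i \<in> {1..t}. x i \<ge> 1" "(\<Sum>i = 1..t. x i) = p"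
    and m: "m = (\<Prod>i = 1..t. fact (x i)) mod int p"
    by (auto simp: factorial_products_def)
  have less: "x i < p" if i: "i \<in> {1..t}" for i
  proof -
    \<comment> \<open>An index other than \<open>i\<close>, whose part is positive and keeps
      \<open>x i\<close> below \<open>p\<close>.\<close>
    have "(if i = 1 then 2 else 1) \<in> {1..t} - {i}" using assms(2) by auto
    then have "{1..t} - {i} \<noteq> {}" by blast
    then have "0 < (\<Sum>j\<in>{1..t} - {i}. x j)" using x(1) by (intro sum_pos) force+
    then show ?thesis using sum.remove[OF _ i, of x] x(2) by simp
  qed
  have "\<not> int p dvd fact (x i)" if "i \<in> {1..t}" for i
    using not_prime_dvd_fact_prod[OF assms(1), of "[x i]"] less[OF that] by simp
  then have "\<not> int p dvd (\<Prod>i = 1..t. fact (x i))"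
    using assms(1) by (subst prime_dvd_prod_iff) auto
  then have "m \<noteq> 0" unfolding m by (simp add: dvd_eq_mod_eq_0)
  moreover have "0 \<le> m" "m < int p" unfolding m using assms(1) by (auto simp: prime_gt_0_nat)
  ultimately show "m \<in> nonzero_residues p"
    using nonzero_residues_eq[OF prime_gt_1_nat[OF assms(1)]] by simp
qed

theorem theorem2:
  fixes p :: nat
  assumes "prime p" and "p \<noteq> 5"
  shows "(\<forall>m \<in> nonzero_residues p. \<exists>t \<ge> 2. \<exists>x :: nat \<Rightarrow> nat.
            (\<forall>i \<in> {1..t}. x i \<ge> 1) \<and> (\<Sum>i = 1..t. x i) = p \<and>
            [(\<Prod>i = 1..t. fact (x i)) = m] (mod int p))
       \<and> (\<Union>t \<in> {2..}. factorial_products p t p) = nonzero_residues p"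
proof (intro conjI ballI equalityI)
  fix m assume "m \<in> nonzero_residues p"
  then show "\<exists>t \<ge> 2. \<exists>x :: nat \<Rightarrow> nat. (\<forall>i \<in> {1..t}. x i \<ge> 1) \<and> (\<Sum>i = 1..t. x i) = p \<and>
      [(\<Prod>i = 1..t. fact (x i)) = m] (mod int p)"
    using composition_exists assms by blast
next
  show "(\<Union>t \<in> {2..}. factorial_products p t p) \<subseteq> nonzero_residues p"
    using factorial_products_subset[OF assms(1)] by (simp add: UN_subset_iff)
next
  show "nonzero_residues p \<subseteq> (\<Union>t \<in> {2..}. factorial_products p t p)"
  proof
    fix m assume m: "m \<in> nonzero_residues p"
    then obtain t and x :: "nat \<Rightarrow> nat" where t: "t \<ge> 2"
      and x: "\<forall>i \<in> {1..t}. x i \<ge> 1" "(\<Sum>i = 1..t. x i) = p"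
      and cong: "[(\<Prod>i = 1..t. fact (x i)) = m] (mod int p)"
      using composition_exists assms by blast
    have "m mod int p = m"
      using m nonzero_residues_eq[OF prime_gt_1_nat[OF assms(1)]] by simp
    with cong have "m = (\<Prod>i = 1..t. fact (x i)) mod int p" by (simp add: cong_def)
    with x have "m \<in> factorial_products p t p" unfolding factorial_products_def by blast
    with t show "m \<in> (\<Union>t \<in> {2..}. factorial_products p t p)" by blast
  qed
qed

end
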